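(* Let $n\geq 3$ and $k\in\mathbb N$. For any $\gamma_1,\ldots,\gamma_k\in\mathbb R$ consider the $k$-tuple of Jordan blocks $J=(\mathrm{Jrd}_{n,\gamma_1},\mathrm{Jrd}_{n,\gamma_2},\ldots,\mathrm{Jrd}_{n,\gamma_k})$ acting on $\mathbb R^n$. Then $J$ is not hypercyclic.
   Context: $\mathbb N$ denotes the positive integers and $\mathbb N_0=\mathbb N\cup\{0\}$. For $l\in\mathbb N$ and $\gamma\in\mathbb R$, $\mathrm{Jrd}_{l,\gamma}$ denotes the $l\times l$ Jordan block with eigenvalue $\gamma$: the diagonal entries equal $\gamma$, the entries on the first superdiagonal equal $1$, and all other entries are $0$. A $k$-tuple $T=(T_1,\ldots,T_k)$ of commuting $n\times n$ real matrices is called hypercyclic if there exists a vector $x\in\mathbb R^n$ such that the set $\{T_1^{m_1}T_2^{m_2}\cdots T_k^{m_k}x : m_1,\ldots,m_k\in\mathbb N_0\}$ is dense in $\mathbb R^n$. *)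

theory Defs
  imports
    "HOL-Analysis.Abstract_Euclidean_Space"
    "Jordan_Normal_Form.Jordan_Normal_Form"
begin

text \<open>
  Vectors and matrices of size \<open>n\<close> are elements of \<^term>\<open>carrier_vec n\<close> and \<^term>\<open>carrier_mat n n\<close>,
  which carry no topology. The usual topology of \<open>n\<close>-space is \<^term>\<open>Euclidean_space n\<close>, whose points
  are the functions on the natural numbers vanishing outside \<^term>\<open>{..<n}\<close>; the following map
  identifies \<^term>\<open>carrier_vec n\<close> with these points.
\<close>

definition euclidean_point :: "real vec \<Rightarrow> nat \<Rightarrow> real" where
  "euclidean_point v = (\<lambda>i. if i < dim_vec v then vec_index v i else 0)"

lemma bij_betw_euclidean_point:
  "bij_betw euclidean_point (carrier_vec n) (topspace (Euclidean_space n))"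
  by (rule bij_betw_byWitness[where f' = "\<lambda>f. vec n f"])
     (auto simp: topspace_Euclidean_space euclidean_point_def fun_eq_iff)

definition dense_vecs :: "nat \<Rightarrow> real vec set \<Rightarrow> bool" where
  "dense_vecs n S \<longleftrightarrow>
     Euclidean_space n closure_of (euclidean_point ` S) = topspace (Euclidean_space n)"

text \<open>For \<open>Ts = [T\<^sub>1, \<dots>, T\<^sub>k]\<close> and \<open>ms = [m\<^sub>1, \<dots>, m\<^sub>k]\<close>, this is the product of the powers
  of the \<open>T\<^sub>i\<close> with exponents \<open>m\<^sub>i\<close>, in this order.\<close>

definition power_prod :: "nat \<Rightarrow> real mat list \<Rightarrow> nat list \<Rightarrow> real mat" where
  "power_prod n Ts ms = foldr (*) (map2 (^\<^sub>m) Ts ms) (1\<^sub>m n)"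

definition orbit_tuple :: "nat \<Rightarrow> real mat list \<Rightarrow> real vec \<Rightarrow> real vec set" where
  "orbit_tuple n Ts x = {power_prod n Ts ms *\<^sub>v x | ms. length ms = length Ts}"

text \<open>The notion is meant for pairwise commuting tuples in \<^term>\<open>carrier_mat n n\<close>; that tuples of
  Jordan blocks are of this kind is the lemma below.\<close>

definition hypercyclic :: "nat \<Rightarrow> real mat list \<Rightarrow> bool" where
  "hypercyclic n Ts \<longleftrightarrow> (\<exists>x \<in> carrier_vec n. dense_vecs n (orbit_tuple n Ts x))"

lemma jordan_block_commute:
  fixes a b :: real
  shows "jordan_block n a * jordan_block n b = jordan_block n b * jordan_block n a"
proof -
  let ?N = "jordan_block n (0::real)"
  have N: "?N \<in> carrier_mat n n" by simp
  have split: "jordan_block n c = ?N + c \<cdot>\<^sub>m 1\<^sub>m n" for c :: real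
    by (intro eq_matI) auto
  have "jordan_block n c * jordan_block n d =
      ?N * ?N + c \<cdot>\<^sub>m ?N + (d \<cdot>\<^sub>m ?N + (c * d) \<cdot>\<^sub>m 1\<^sub>m n)" for c d :: real
  proof -
    have "jordan_block n c * jordan_block n d =
        (?N + c \<cdot>\<^sub>m 1\<^sub>m n) * ?N + (?N + c \<cdot>\<^sub>m 1\<^sub>m n) * (d \<cdot>\<^sub>m 1\<^sub>m n)"
      by (subst (1 2) split, rule mult_add_distrib_mat) auto
    also have "(?N + c \<cdot>\<^sub>m 1\<^sub>m n) * ?N = ?N * ?N + c \<cdot>\<^sub>m ?N"
      by (subst add_mult_distrib_mat[where nr = n and n = n and nc = n])
         (auto simp: mult_smult_assoc_mat[where nr = n and n = n and nc = n])
    also have "(?N + c \<cdot>\<^sub>m 1\<^sub>m n) * (d \<cdot>\<^sub>m 1\<^sub>m n) = d \<cdot>\<^sub>m ?N + (c * d) \<cdot>\<^sub>m 1\<^sub>m n"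
      by (subst mult_smult_distrib[where nr = n and n = n and nc = n])
         (auto simp: algebra_simps intro!: eq_matI)
    finally show ?thesis .
  qed
  from this[of a b] this[of b a] show ?thesis
    by (auto simp: algebra_simps intro!: eq_matI)
qed

end

theory Submission
  imports Defs
begin

text \<open>
  Write \<open>N\<close> for the nilpotent Jordan block. A product of powers of the blocks is \<open>p(N)\<close> for a
  polynomial \<open>p = p\<^sub>0 + p\<^sub>1 X + p\<^sub>2 X\<^sup>2 + \<dots>\<close> that is a product of factors \<open>X + \<gamma>\<^sub>j\<close>, and the last
  three coordinates of \<open>p(N) x\<close> depend on \<open>p\<^sub>0\<close>, \<open>p\<^sub>1\<close>, \<open>p\<^sub>2\<close> only. As \<open>p\<close> has only real roots,
  it satisfies the Newton-type inequality \<open>2 p\<^sub>0 p\<^sub>2 \<le> p\<^sub>1\<^sup>2\<close>: multiplication by \<open>X + \<gamma>\<close> replaces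
  \<open>q = p\<^sub>1\<^sup>2 - 2 p\<^sub>0 p\<^sub>2\<close> by \<open>\<gamma>\<^sup>2 q + p\<^sub>0\<^sup>2\<close>. So the orbit avoids a nonempty open set.
\<close>

lemma jordan_block_mult_vec_index:
  fixes \<gamma> :: "'a::comm_ring_1"
  assumes v: "v \<in> carrier_vec n" and i: "i < n"
  shows "(jordan_block n \<gamma> *\<^sub>v v) $ i = \<gamma> * v $ i + (if Suc i < n then v $ Suc i else 0)"
proof -
  have "(jordan_block n \<gamma> *\<^sub>v v) $ i = (\<Sum>j = 0..<n. jordan_block n \<gamma> $$ (i, j) * v $ j)"
    using assms by (auto simp: scalar_prod_def intro!: sum.cong)
  also have "\<dots> = (\<Sum>j = 0..<n. (if j = i then \<gamma> * v $ j else 0) + (if j = Suc i then v $ j else 0))"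
    using i by (intro sum.cong) auto
  also have "\<dots> = \<gamma> * v $ i + (if Suc i < n then v $ Suc i else 0)"
    using i by (simp add: sum.distrib)
  finally show ?thesis .
qed

lemma pow_mat_mult_vec_invariant:
  fixes A :: "'a::semiring_1 mat"
  assumes A: "A \<in> carrier_mat n n" and V: "V \<subseteq> carrier_vec n"
    and inv: "\<And>v. v \<in> V \<Longrightarrow> A *\<^sub>v v \<in> V" and v: "v \<in> V"
  shows "(A ^\<^sub>m m) *\<^sub>v v \<in> V"
  using v
proof (induction m arbitrary: v)
  case 0
  then show ?case using A V by auto
next
  case (Suc m)
  have "(A ^\<^sub>m Suc m) *\<^sub>v v = (A ^\<^sub>m m) *\<^sub>v (A *\<^sub>v v)"
    using A V Suc.prems by (simp add: assoc_mult_mat_vec[OF pow_carrier_mat[OF A] A] subsetD)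
  then show ?case using Suc.IH[OF inv[OF Suc.prems]] by simp
qed

lemma power_prod_carrier:
  assumes "set Ts \<subseteq> carrier_mat n n"
  shows "power_prod n Ts ms \<in> carrier_mat n n"
  using assms
proof (induction Ts arbitrary: ms)
  case Nil
  then show ?case by (simp add: power_prod_def)
next
  case (Cons A Ts)
  then show ?case
    by (cases ms) (auto simp: power_prod_def intro!: mult_carrier_mat pow_carrier_mat)
qed

text \<open>Reduces a claim about all products of powers to closure of \<open>V\<close> under each
  single matrix.\<close>

lemma orbit_tuple_invariant:
  assumes Ts: "set Ts \<subseteq> carrier_mat n n" and V: "V \<subseteq> carrier_vec n"
    and inv: "\<And>A v. A \<in> set Ts \<Longrightarrow> v \<in> V \<Longrightarrow> A *\<^sub>v v \<in> V" and x: "x \<in> V"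
  shows "orbit_tuple n Ts x \<subseteq> V"
proof -
  have "power_prod n Ts ms *\<^sub>v x \<in> V" for ms
    using Ts inv
  proof (induction Ts arbitrary: ms)
    case Nil
    then show ?case using x V by (auto simp: power_prod_def)
  next
    case (Cons A Ts)
    show ?case
    proof (cases ms)
      case Nil
      \<comment> \<open>\<open>map2\<close> truncates to the shorter list, so the product is the
        identity matrix here.\<close>
      then show ?thesis using x V by (auto simp: power_prod_def)
    next
      case (Cons m ms')
      have A: "A \<in> carrier_mat n n" using Cons.prems(1) by simp
      have P: "power_prod n Ts ms' \<in> carrier_mat n n"
        using Cons.prems(1) by (simp add: power_prod_carrier)
      have "power_prod n (A # Ts) ms *\<^sub>v x = (A ^\<^sub>m m) *\<^sub>v (power_prod n Ts ms' *\<^sub>v x)"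
        using assoc_mult_mat_vec[OF pow_carrier_mat[OF A] P, of x m] x V Cons
        by (auto simp: power_prod_def)
      moreover have "power_prod n Ts ms' *\<^sub>v x \<in> V"
        using Cons.prems by (intro Cons.IH) auto
      ultimately show ?thesis
        using pow_mat_mult_vec_invariant[OF A V, of "power_prod n Ts ms' *\<^sub>v x" m] Cons.prems(2)
        by simp
    qed
  qed
  then show ?thesis by (auto simp: orbit_tuple_def)
qed

lemma continuous_map_Euclidean_space_proj:
  "continuous_map (Euclidean_space n) euclideanreal (\<lambda>f. f i)"
  unfolding Euclidean_space_def
  by (intro continuous_map_from_subtopology continuous_map_product_projection) simp

text \<open>The set where \<open>F\<close> is negative is open, contains \<open>z\<close> and misses
  \<open>S\<close>, so \<open>z\<close> is not in the closure.\<close>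

lemma not_dense_vecsI:
  assumes cont: "continuous_map (Euclidean_space n) euclideanreal F"
    and nonneg: "\<And>v. v \<in> S \<Longrightarrow> 0 \<le> F (euclidean_point v)"
    and z: "z \<in> topspace (Euclidean_space n)" "F z < 0"
  shows "\<not> dense_vecs n S"
proof
  assume "dense_vecs n S"
  then have "z \<in> Euclidean_space n closure_of (euclidean_point ` S)"
    using z by (simp add: dense_vecs_def)
  moreover have "openin (Euclidean_space n) {f \<in> topspace (Euclidean_space n). F f \<in> {..<0}}"
    (is "openin _ ?U")
    by (rule openin_continuous_map_preimage[OF cont]) simp
  moreover have "z \<in> ?U" using z by simp
  ultimately obtain f where "f \<in> euclidean_point ` S" "f \<in> ?U"
    unfolding in_closure_of by meson
  then show False using nonneg by force
qed

text \<open>The vectors \<open>p(N) x\<close> in dimension \<open>m + 3\<close> with \<open>2 p\<^sub>0 p\<^sub>2 \<le> p\<^sub>1\<^sup>2\<close>, as far as their last three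
  coordinates can tell.\<close>

definition newton_tail :: "nat \<Rightarrow> real vec \<Rightarrow> real vec set" where
  "newton_tail m x = {v \<in> carrier_vec (m + 3). \<exists>p0 p1 p2.
     v $ (m + 2) = p0 * x $ (m + 2) \<and>
     v $ (m + 1) = p0 * x $ (m + 1) + p1 * x $ (m + 2) \<and>
     v $ m = p0 * x $ m + p1 * x $ (m + 1) + p2 * x $ (m + 2) \<and>
     2 * p0 * p2 \<le> p1\<^sup>2}"

lemma newton_tail_self:
  assumes "x \<in> carrier_vec (m + 3)"
  shows "x \<in> newton_tail m x"
proof -
  \<comment> \<open>The constant polynomial \<open>p = 1\<close>.\<close>
  have "x $ (m + 2) = 1 * x $ (m + 2) \<and> x $ (m + 1) = 1 * x $ (m + 1) + 0 * x $ (m + 2) \<and>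
    x $ m = 1 * x $ m + 0 * x $ (m + 1) + 0 * x $ (m + 2) \<and> 2 * 1 * 0 \<le> (0::real)\<^sup>2"
    by simp
  with assms show ?thesis unfolding newton_tail_def by blast
qed

text \<open>The block acts as multiplication of p by X + \<gamma>, so the new coefficients are
  \<gamma> p0, \<gamma> p1 + p0 and \<gamma> p2 + p1.\<close>

lemma newton_tail_jordan_block:
  assumes "v \<in> newton_tail m x"
  shows "jordan_block (m + 3) \<gamma> *\<^sub>v v \<in> newton_tail m x"
proof -
  from assms obtain p0 p1 p2 where v: "v \<in> carrier_vec (m + 3)"
    and p: "v $ (m + 2) = p0 * x $ (m + 2)"
      "v $ (m + 1) = p0 * x $ (m + 1) + p1 * x $ (m + 2)"
      "v $ m = p0 * x $ m + p1 * x $ (m + 1) + p2 * x $ (m + 2)"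
    and q: "2 * p0 * p2 \<le> p1\<^sup>2"
    by (auto simp: newton_tail_def)
  let ?w = "jordan_block (m + 3) \<gamma> *\<^sub>v v"
  have "?w $ (m + 2) = \<gamma> * v $ (m + 2)" "?w $ (m + 1) = \<gamma> * v $ (m + 1) + v $ (m + 2)"
    "?w $ m = \<gamma> * v $ m + v $ (m + 1)"
    using v by (auto simp: jordan_block_mult_vec_index simp del: index_mult_mat_vec)
  then have "?w $ (m + 2) = (\<gamma> * p0) * x $ (m + 2)"
    "?w $ (m + 1) = (\<gamma> * p0) * x $ (m + 1) + (\<gamma> * p1 + p0) * x $ (m + 2)"
    "?w $ m = (\<gamma> * p0) * x $ m + (\<gamma> * p1 + p0) * x $ (m + 1) + (\<gamma> * p2 + p1) * x $ (m + 2)"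
    by (simp_all only: p) (simp_all add: algebra_simps)
  moreover have "2 * (\<gamma> * p0) * (\<gamma> * p2 + p1) \<le> (\<gamma> * p1 + p0)\<^sup>2"
  proof -
    have "(\<gamma> * p1 + p0)\<^sup>2 - 2 * (\<gamma> * p0) * (\<gamma> * p2 + p1) = \<gamma>\<^sup>2 * (p1\<^sup>2 - 2 * p0 * p2) + p0\<^sup>2"
      by (simp add: power2_eq_square algebra_simps)
    also have "\<dots> \<ge> 0" using q by simp
    finally show ?thesis by simp
  qed
  moreover have "?w \<in> carrier_vec (m + 3)" using v
    by (metis jordan_block_carrier mult_mat_vec_carrier)
  ultimately show ?thesis unfolding newton_tail_def by blast
qed

text \<open>If the last coordinate of \<open>x\<close> is 0, it is 0 throughout the set. Otherwise
  the last three coordinates of a vector determine p0, p1, p2, and the Newton inequality becomes a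
  polynomial inequality in these coordinates that fails somewhere.\<close>

lemma not_dense_newton_tail: "\<not> dense_vecs (m + 3) (newton_tail m x)"
proof (cases "x $ (m + 2) = 0")
  case True
  show ?thesis
  proof (rule not_dense_vecsI)
    show "continuous_map (Euclidean_space (m + 3)) euclideanreal (\<lambda>f. f (m + 2))"
      by (rule continuous_map_Euclidean_space_proj)
    show "0 \<le> euclidean_point v (m + 2)" if "v \<in> newton_tail m x" for v
      using that True by (auto simp: newton_tail_def euclidean_point_def)
    show "(\<lambda>i. if i = m + 2 then -1 else 0) \<in> topspace (Euclidean_space (m + 3))"
      by (auto simp: topspace_Euclidean_space)
  qed simp
next
  case False
  define a b d where "a = x $ (m + 2)" and "b = x $ (m + 1)" and "d = x $ m"
  \<comment> \<open>\<open>a\<^sup>4 (p\<^sub>1\<^sup>2 - 2 p\<^sub>0 p\<^sub>2)\<close>, with the \<open>p\<^sub>i\<close> eliminated in favour of the coordinates\<close>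
  define Q where "Q f = (a * f (m + 1) - b * f (m + 2))\<^sup>2 - 2 * f (m + 2) *
    (a\<^sup>2 * f m - a * d * f (m + 2) - b * (a * f (m + 1) - b * f (m + 2)))" for f :: "nat \<Rightarrow> real"
  show ?thesis
  proof (rule not_dense_vecsI)
    show "continuous_map (Euclidean_space (m + 3)) euclideanreal Q"
      unfolding Q_def[abs_def]
      by (intro continuous_intros continuous_map_Euclidean_space_proj)
    show "0 \<le> Q (euclidean_point v)" if v: "v \<in> newton_tail m x" for v
    proof -
      from v obtain p0 p1 p2 where "dim_vec v = m + 3" "v $ (m + 2) = p0 * a"
        "v $ (m + 1) = p0 * b + p1 * a" "v $ m = p0 * d + p1 * b + p2 * a"
        and q: "2 * p0 * p2 \<le> p1\<^sup>2"
        by (auto simp: newton_tail_def a_def b_def d_def)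
      then have "Q (euclidean_point v) = a ^ 4 * (p1\<^sup>2 - 2 * p0 * p2)"
        by (simp add: Q_def euclidean_point_def algebra_simps power2_eq_square power4_eq_xxxx)
      with q show ?thesis by simp
    qed
    \<comment> \<open>the point with \<open>p = 1 + X\<^sup>2\<close>\<close>
    let ?z = "\<lambda>i. if i = m + 2 then a else if i = m + 1 then b else if i = m then d + a else 0"
    show "?z \<in> topspace (Euclidean_space (m + 3))"
      by (auto simp: topspace_Euclidean_space)
    have "Q ?z = - 2 * a ^ 4"
      by (simp add: Q_def algebra_simps power2_eq_square power4_eq_xxxx)
    then show "Q ?z < 0" using False by (simp add: a_def)
  qed
qed

lemma dense_vecs_mono:
  assumes "dense_vecs n S" and "S \<subseteq> S'"
  shows "dense_vecs n S'"
  using assms closure_of_mono[of "euclidean_point ` S" "euclidean_point ` S'" "Euclidean_space n"]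
    closure_of_subset_topspace[of "Euclidean_space n" "euclidean_point ` S'"]
  by (auto simp: dense_vecs_def)

theorem proposition1p7:
  fixes n k :: nat and \<gamma> :: "real list"
  assumes "n \<ge> 3" and "k \<ge> 1" and "length \<gamma> = k"
  shows "\<not> hypercyclic n (map (jordan_block n) \<gamma>)"
proof
  assume "hypercyclic n (map (jordan_block n) \<gamma>)"
  then obtain x where x: "x \<in> carrier_vec n"
    and dense: "dense_vecs n (orbit_tuple n (map (jordan_block n) \<gamma>) x)"
    by (auto simp: hypercyclic_def)
  \<comment> \<open>The last three indices become \<open>m\<close>, \<open>m + 1\<close>,
    \<open>m + 2\<close>, free of truncated subtraction.\<close>
  obtain m where n: "n = m + 3"
    using \<open>n \<ge> 3\<close> by (metis add.commute le_Suc_ex)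
  have "orbit_tuple n (map (jordan_block n) \<gamma>) x \<subseteq> newton_tail m x"
    using x unfolding n
  proof (intro orbit_tuple_invariant newton_tail_self)
    show "newton_tail m x \<subseteq> carrier_vec (m + 3)" by (auto simp: newton_tail_def)
  qed (auto intro: newton_tail_jordan_block)
  then show False
    using dense_vecs_mono[OF dense] not_dense_newton_tail n by blast
qed

end
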